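(* Let $A_1$ be the first Weyl algebra, over $\mathbf{Q}$ or over a ring containing $\mathbf{Q}$, with generators $x$, $d/dx$, let $\hat A_1$ be its completion by the degree of differential operator, and let $k,\lambda$ be formal commuting variables. Then for any $F=F(d/dx)\in\mathbf{Q}[[d/dx]]$ there is a unique $\alpha=\alpha(\lambda,d/dx)\in\mathbf{Q}[[\lambda,d/dx]]$ such that in $\hat A_1[[\lambda,k]]$ $$\exp(\lambda xF)=\sum_{s=0}^\infty\frac{x^s\alpha^s}{s!}.$$ Moreover, let $\alpha(\lambda,k)$ denote the power series with the same coefficients as $\alpha(\lambda,d/dx)$, obtained by substituting $k$ for $d/dx$. Then $$\exp\bigl(\lambda xF(d/dx)\bigr)\bigl(\exp(kx)\bigr)=\exp\bigl((\alpha(\lambda,k)+k)\,x\bigr)$$ holds true in $\hat A_1[[\lambda,k]]$.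
   Context: The first Weyl algebra is generated by $x$ and $d/dx$ with $[d/dx,x]=1$. In the completion $\hat A_1$, formal power series in $d/dx$ are allowed (with coefficients polynomial in $x$). The variables $\lambda,k$ commute with everything. Exponentials are the usual power series. In the first identity $\alpha$ does not commute with $x$ in general, and in each summand $x^s\alpha^s$ all factors $x$ stand to the left of all factors $\alpha$ (a normally ordered exponential). In the second identity the left-hand side is the result of applying the operator $\exp(\lambda xF(d/dx))$ to $\exp(kx)$, where $x$ acts by multiplication and $d/dx$ by differentiation. *)

theory Defs
  imports "HOL-Library.Poly_Mapping" "HOL-Computational_Algebra.Formal_Power_Series"
begin

section \<open>Rings containing the rationals\<close>

text \<open>
  The unital ring homomorphism from the rationals is part of the structure; it is unique, and
  it is injective because \<^class>\<open>ring_1\<close> includes \<open>0 \<noteq> 1\<close>.  The ring need not be commutative, but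
  the image of the rationals is automatically central.
\<close>

class rat_algebra_1 = ring_1 +
  fixes of_Q :: "rat \<Rightarrow> 'a"
  assumes of_Q_1: "of_Q 1 = 1"
    and of_Q_add: "of_Q (p + q) = of_Q p + of_Q q"
    and of_Q_mult: "of_Q (p * q) = of_Q p * of_Q q"

instantiation rat :: rat_algebra_1
begin
definition of_Q_rat :: "rat \<Rightarrow> rat" where "of_Q_rat q = q"
instance by standard (simp_all add: of_Q_rat_def)
end

instantiation poly_mapping :: (monoid_add, rat_algebra_1) rat_algebra_1
begin
definition of_Q_poly_mapping :: "rat \<Rightarrow> 'a \<Rightarrow>\<^sub>0 'b" where
  "of_Q_poly_mapping q = Poly_Mapping.single 0 (of_Q q)"
instance
  by standard (simp_all add: of_Q_poly_mapping_def of_Q_1 of_Q_add of_Q_mult single_add mult_single)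
end

instantiation fps :: (rat_algebra_1) rat_algebra_1
begin
definition of_Q_fps :: "rat \<Rightarrow> 'a fps" where "of_Q_fps q = fps_const (of_Q q)"
instance
  by standard (simp_all add: of_Q_fps_def of_Q_1 of_Q_add of_Q_mult)
end

lemma of_Q_0: "of_Q 0 = 0"
  using of_Q_add[of 0 0] by simp

lemma of_Q_of_nat: "of_Q (of_nat n) = of_nat n"
  by (induction n) (simp_all add: of_Q_0 of_Q_1 of_Q_add)

lemma of_nat_mult_eq_0_imp:
  fixes a :: "'a::rat_algebra_1"
  assumes "of_nat n * a = 0" "n > 0"
  shows "a = 0"
proof -
  have "a = of_Q (inverse (of_nat n) * of_nat n) * a"
    using assms(2) by (simp add: of_Q_1)
  also have "\<dots> = of_Q (inverse (of_nat n)) * (of_nat n * a)"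
    by (simp only: of_Q_mult of_Q_of_nat mult.assoc)
  finally show ?thesis using assms(1) by simp
qed


section \<open>Polynomials in \<open>x\<close> and their derivative\<close>

text \<open>
  \<open>R[x]\<close> is the type \<open>nat \<Rightarrow>\<^sub>0 'a\<close>: unlike \<open>'a poly\<close> it is a ring also for noncommutative \<open>R\<close>,
  and \<open>pderiv\<close> would moreover exclude zero divisors.
\<close>

definition poly_x :: "nat \<Rightarrow>\<^sub>0 'a::semiring_1" where
  "poly_x = Poly_Mapping.single 1 1"

lift_definition pm_deriv :: "(nat \<Rightarrow>\<^sub>0 'a::semiring_1) \<Rightarrow> (nat \<Rightarrow>\<^sub>0 'a)"
  is "\<lambda>f m. of_nat (Suc m) * f (Suc m)"
proof -
  fix f :: "nat \<Rightarrow> 'a" assume "finite {m. f m \<noteq> 0}"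
  then have "finite (Suc -` {m. f m \<noteq> 0})" by (intro finite_vimageI) auto
  then show "finite {m. of_nat (Suc m) * f (Suc m) \<noteq> 0}"
    by (rule rev_finite_subset) auto
qed

lemma pm_deriv_add: "pm_deriv (p + q) = pm_deriv p + pm_deriv q"
  by (rule poly_mapping_eqI) (simp add: pm_deriv.rep_eq lookup_add distrib_left)

lemma pm_deriv_0 [simp]: "pm_deriv 0 = 0"
  by (rule poly_mapping_eqI) (simp add: pm_deriv.rep_eq)

lemma pm_deriv_1 [simp]: "pm_deriv 1 = 0"
  by (rule poly_mapping_eqI) (simp add: pm_deriv.rep_eq lookup_one)

lemma pm_deriv_poly_x [simp]: "pm_deriv poly_x = 1"
  by (rule poly_mapping_eqI)
    (auto simp: pm_deriv.rep_eq poly_x_def lookup_one lookup_single when_def)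

lemma pm_deriv_single:
  "pm_deriv (Poly_Mapping.single n c) = Poly_Mapping.single (n - 1) (of_nat n * c)"
  by (cases n; rule poly_mapping_eqI)
    (auto simp: pm_deriv.rep_eq lookup_single when_def simp del: of_nat_Suc)

lemma pm_induct [case_names zero single add]:
  fixes p :: "nat \<Rightarrow>\<^sub>0 'a::comm_monoid_add"
  assumes z: "P 0" and s: "\<And>k c. P (Poly_Mapping.single k c)"
    and a: "\<And>p q. P p \<Longrightarrow> P q \<Longrightarrow> P (p + q)"
  shows "P p"
proof (induction p rule: update_induct)
  case const
  show ?case by (rule z)
next
  case (update f k b)
  have "Poly_Mapping.update k b f = f + Poly_Mapping.single k b"
    using update(1)
    by (intro poly_mapping_eqI)
      (auto simp: lookup_update lookup_add lookup_single when_def in_keys_iff)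
  then show ?case using a[OF update(3) s] by simp
qed

lemma pm_deriv_mult:
  "pm_deriv (p * q) = pm_deriv p * q + p * pm_deriv (q :: nat \<Rightarrow>\<^sub>0 'a::semiring_1)"
proof (induction p rule: pm_induct)
  case zero
  show ?case by simp
next
  case (add p1 p2)
  then show ?case by (simp add: distrib_right pm_deriv_add add_ac)
next
  case (single k c)
  show ?case
  proof (induction q rule: pm_induct)
    case zero
    show ?case by simp
  next
    case (add q1 q2)
    then show ?case by (simp add: distrib_left pm_deriv_add add_ac)
  next
    case (single l d)
    have [simp]: "c * (of_nat n * d) = of_nat n * (c * d)" for n
      by (metis mult.assoc mult_of_nat_commute)
    have "pm_deriv (Poly_Mapping.single k c * Poly_Mapping.single l d)
        = Poly_Mapping.single (k + l - 1) (of_nat k * (c * d))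
          + Poly_Mapping.single (k + l - 1) (of_nat l * (c * d))"
      by (simp add: mult_single pm_deriv_single distrib_right flip: single_add)
    also have "Poly_Mapping.single (k + l - 1) (of_nat k * (c * d))
        = pm_deriv (Poly_Mapping.single k c) * Poly_Mapping.single l d"
      by (cases k) (simp_all add: mult_single pm_deriv_single mult.assoc del: of_nat_Suc)
    also have "Poly_Mapping.single (k + l - 1) (of_nat l * (c * d))
        = Poly_Mapping.single k c * pm_deriv (Poly_Mapping.single l d)"
      by (cases l) (simp_all add: mult_single pm_deriv_single del: of_nat_Suc)
    finally show ?case .
  qed
qed

lemma pm_deriv_pow_0 [simp]: "(pm_deriv ^^ n) 0 = 0"
  by (induction n) auto

lemma pm_deriv_pow_add: "(pm_deriv ^^ n) (p + q) = (pm_deriv ^^ n) p + (pm_deriv ^^ n) q"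
  by (induction n) (auto simp: pm_deriv_add)

lemma pm_deriv_pow_sum: "(pm_deriv ^^ n) (\<Sum>i\<in>I. p i) = (\<Sum>i\<in>I. (pm_deriv ^^ n) (p i))"
  by (induction I rule: infinite_finite_induct) (auto simp: pm_deriv_pow_add)

lemma lookup_pm_deriv_pow:
  "Poly_Mapping.lookup ((pm_deriv ^^ n) p) m
     = of_nat (pochhammer (Suc m) n) * Poly_Mapping.lookup p (m + n)"
proof (induction n arbitrary: m)
  case (Suc n)
  then show ?case
    by (simp add: pm_deriv.rep_eq pochhammer_rec mult.assoc del: of_nat_Suc mult_Suc)
qed simp

lemma pm_deriv_pow_eventually_0: "\<exists>N. \<forall>n\<ge>N. (pm_deriv ^^ n) p = 0"
proof -
  obtain N where N: "Poly_Mapping.keys p \<subseteq> {..<N}"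
    using finite_nat_set_iff_bounded finite_keys by (metis lessThan_iff subsetI)
  have "(pm_deriv ^^ n) p = 0" if "n \<ge> N" for n
  proof (rule poly_mapping_eqI)
    fix m
    have "m + n \<notin> Poly_Mapping.keys p" using N that by auto
    then show "Poly_Mapping.lookup ((pm_deriv ^^ n) p) m = Poly_Mapping.lookup 0 m"
      by (simp add: lookup_pm_deriv_pow in_keys_iff)
  qed
  then show ?thesis by blast
qed

lemma finite_pm_deriv_pow: "finite {n. (pm_deriv ^^ n) p \<noteq> 0}"
proof -
  obtain N where "\<forall>n\<ge>N. (pm_deriv ^^ n) p = 0" using pm_deriv_pow_eventually_0 by blast
  then have "{n. (pm_deriv ^^ n) p \<noteq> 0} \<subseteq> {..<N}" using not_less by auto
  then show ?thesis using finite_subset by blast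
qed

lemma sum_pm_deriv_bound:
  assumes "\<forall>n\<ge>N. (pm_deriv ^^ n) p = 0" and "\<And>n. (pm_deriv ^^ n) p = 0 \<Longrightarrow> f n = 0"
  shows "(\<Sum>n | (pm_deriv ^^ n) p \<noteq> 0. f n) = (\<Sum>n<N. f n)"
  using assms by (intro sum.mono_neutral_left) (auto simp: not_less[symmetric])

lemma pm_leibniz:
  "(pm_deriv ^^ n) (p * q)
     = (\<Sum>j\<le>n. of_nat (n choose j) * (pm_deriv ^^ j) p * (pm_deriv ^^ (n - j)) q)"
  for p q :: "nat \<Rightarrow>\<^sub>0 'a::ring_1"
proof (induction n arbitrary: p q)
  case (Suc n)
  let ?d = "\<lambda>j. (pm_deriv ^^ j)"
  let ?t = "\<lambda>c i j. of_nat c * ?d i p * ?d j q"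
  have "?d (Suc n) (p * q) = ?d n (pm_deriv p * q) + ?d n (p * pm_deriv q)"
    by (simp add: funpow_swap1 pm_deriv_mult pm_deriv_pow_add)
  also have "?d n (pm_deriv p * q) = (\<Sum>j\<le>n. ?t (n choose j) (Suc j) (n - j))"
    by (subst Suc) (simp add: funpow_swap1)
  also have "?d n (p * pm_deriv q) = (\<Sum>j\<le>n. ?t (n choose j) j (Suc n - j))"
    by (subst Suc) (intro sum.cong refl, simp add: Suc_diff_le funpow_swap1)
  also have "\<dots> = (\<Sum>j\<le>Suc n. ?t (n choose j) j (Suc n - j))"
    by (simp add: binomial_eq_0)
  also have "\<dots> = ?t 1 0 (Suc n) + (\<Sum>j\<le>n. ?t (n choose Suc j) (Suc j) (n - j))"
    by (subst sum.atMost_Suc_shift) simp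
  finally have *: "?d (Suc n) (p * q) = ?t 1 0 (Suc n)
      + (\<Sum>j\<le>n. ?t (n choose j) (Suc j) (n - j) + ?t (n choose Suc j) (Suc j) (n - j))"
    by (simp add: sum.distrib add_ac)
  show ?case unfolding *
    by (subst sum.atMost_Suc_shift) (simp add: distrib_right del: funpow.simps)
qed simp


section \<open>The completed first Weyl algebra\<close>

text \<open>
  An element \<open>\<Sum>n. a\<^sub>n(x) D\<^sup>n\<close> of the completion, with \<open>D = d/dx\<close>, is represented by its normally
  ordered coefficients \<open>a\<^sub>n \<in> R[x]\<close>.
\<close>

typedef (overloaded) 'a weyl = "UNIV :: (nat \<Rightarrow>\<^sub>0 'a::zero) fps set"
  morphisms dseries Weyl
  by simp

lemmas weyl_inverse [simp] = Weyl_inverse[OF UNIV_I] dseries_inverse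

definition dcoeff :: "'a::zero weyl \<Rightarrow> nat \<Rightarrow> (nat \<Rightarrow>\<^sub>0 'a)" where
  "dcoeff A n = fps_nth (dseries A) n"

lemma dcoeff_Weyl: "dcoeff (Weyl f) n = fps_nth f n"
  by (simp add: dcoeff_def)

lemma weyl_eqI: "(\<And>n. dcoeff A n = dcoeff B n) \<Longrightarrow> A = B"
  by (metis dcoeff_def fps_ext dseries_inject)

instantiation weyl :: (ab_group_add) ab_group_add
begin
definition zero_weyl :: "'a weyl" where "0 = Weyl 0"
definition plus_weyl :: "'a weyl \<Rightarrow> 'a weyl \<Rightarrow> 'a weyl" where
  "A + B = Weyl (dseries A + dseries B)"
definition minus_weyl :: "'a weyl \<Rightarrow> 'a weyl \<Rightarrow> 'a weyl" where
  "A - B = Weyl (dseries A - dseries B)"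
definition uminus_weyl :: "'a weyl \<Rightarrow> 'a weyl" where "- A = Weyl (- dseries A)"
instance
  by standard (simp_all add: zero_weyl_def plus_weyl_def minus_weyl_def uminus_weyl_def add_ac)
end

lemma dcoeff_0 [simp]: "dcoeff 0 n = 0"
  by (simp add: dcoeff_def zero_weyl_def)

lemma dcoeff_add [simp]: "dcoeff (A + B) n = dcoeff A n + dcoeff B n"
  by (simp add: dcoeff_def plus_weyl_def)

lemma dcoeff_diff [simp]: "dcoeff (A - B) n = dcoeff A n - dcoeff B n"
  by (simp add: dcoeff_def minus_weyl_def)

text \<open>
  The product is forced by \<open>D\<^sup>m b = (\<Sum>j\<le>m. (m choose j) b\<^sup>(\<^sup>j\<^sup>) D\<^bsup>m-j\<^esup>)\<close> for \<open>b \<in> R[x]\<close>: the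
  summand below comes from \<open>a\<^sub>m D\<^sup>m \<cdot> b\<^sub>n D\<^sup>n\<close> with \<open>m = N - n + j\<close>.
\<close>

instantiation weyl :: (ring_1) "{one, times}"
begin
definition one_weyl :: "'a weyl" where "1 = Weyl 1"
definition times_weyl :: "'a weyl \<Rightarrow> 'a weyl \<Rightarrow> 'a weyl" where
  "A * B = Weyl (Abs_fps (\<lambda>N. \<Sum>n\<le>N. \<Sum>j | (pm_deriv ^^ j) (dcoeff B n) \<noteq> 0.
     of_nat ((N - n + j) choose j) * dcoeff A (N - n + j) * (pm_deriv ^^ j) (dcoeff B n)))"
instance ..
end

lemma dcoeff_one: "dcoeff 1 n = (if n = 0 then 1 else 0)"
  by (simp add: dcoeff_def one_weyl_def)

lemma dcoeff_mult: "dcoeff (A * B) N =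
   (\<Sum>n\<le>N. \<Sum>j | (pm_deriv ^^ j) (dcoeff B n) \<noteq> 0.
     of_nat ((N - n + j) choose j) * dcoeff A (N - n + j) * (pm_deriv ^^ j) (dcoeff B n))"
  by (simp add: times_weyl_def dcoeff_Weyl)

text \<open>The action on \<open>R[x]\<close>: \<open>x\<close> multiplies and \<open>D\<close> differentiates.\<close>

definition weyl_act :: "'a::ring_1 weyl \<Rightarrow> (nat \<Rightarrow>\<^sub>0 'a) \<Rightarrow> (nat \<Rightarrow>\<^sub>0 'a)" where
  "weyl_act A p = (\<Sum>n | (pm_deriv ^^ n) p \<noteq> 0. dcoeff A n * (pm_deriv ^^ n) p)"

lemma weyl_act_bound:
  assumes "\<forall>n\<ge>N. (pm_deriv ^^ n) p = 0"
  shows "weyl_act A p = (\<Sum>n<N. dcoeff A n * (pm_deriv ^^ n) p)"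
  unfolding weyl_act_def by (rule sum_pm_deriv_bound[OF assms]) simp

lemma weyl_act_diff: "weyl_act (A - B) p = weyl_act A p - weyl_act B p"
  by (simp add: weyl_act_def left_diff_distrib sum_subtractf)

lemma weyl_act_mult: "weyl_act (A * B) p = weyl_act A (weyl_act B p)"
proof -
  let ?d = "\<lambda>j. (pm_deriv ^^ j)"
  let ?a = "dcoeff A" and ?b = "dcoeff B"
  obtain K where K: "\<forall>n\<ge>K. ?d n p = 0" using pm_deriv_pow_eventually_0 by blast
  have "\<forall>n. \<exists>m. \<forall>j\<ge>m. ?d j (?b n) = 0" using pm_deriv_pow_eventually_0 by blast
  from choice[OF this] obtain m where m: "\<And>n. \<forall>j\<ge>m n. ?d j (?b n) = 0" by blast
  define M where "M = (\<Sum>n<K. m n)"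
  have M: "\<forall>j\<ge>M. ?d j (?b n) = 0" if "n < K" for n
  proof -
    have "m n \<le> M" unfolding M_def using that by (intro member_le_sum) auto
    then show ?thesis using m by auto
  qed
  define g where "g n j r = of_nat ((r + j) choose j) * ?a (r + j) * ?d j (?b n) * ?d (n + r) p"
    for n j r
  have g0: "g n j r = 0" if "n < K" "j \<ge> M \<or> n + r \<ge> K" for n j r
  proof -
    have "?d j (?b n) = 0 \<or> ?d (n + r) p = 0" using that M[of n] K by blast
    then show ?thesis unfolding g_def by (elim disjE) simp_all
  qed
  define T where "T = (\<Sum>n<K. \<Sum>j<M. \<Sum>r<K. g n j r)"

  have "weyl_act (A * B) p = (\<Sum>N<K. dcoeff (A * B) N * ?d N p)"
    by (rule weyl_act_bound[OF K])
  also have "\<dots> = (\<Sum>N<K. \<Sum>n\<le>N. \<Sum>j<M. g n j (N - n))"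
  proof (intro sum.cong refl)
    fix N assume N: "N \<in> {..<K}"
    have "dcoeff (A * B) N = (\<Sum>n\<le>N. \<Sum>j<M.
        of_nat ((N - n + j) choose j) * ?a (N - n + j) * ?d j (?b n))"
      unfolding dcoeff_mult using N by (intro sum.cong refl sum_pm_deriv_bound M) auto
    then show "dcoeff (A * B) N * ?d N p = (\<Sum>n\<le>N. \<Sum>j<M. g n j (N - n))"
      unfolding g_def by (simp only: sum_distrib_right) (intro sum.cong refl, simp)
  qed
  also have "\<dots> = (\<Sum>(N, n)\<in>(SIGMA N:{..<K}. {..N}). \<Sum>j<M. g n j (N - n))"
    by (subst sum.Sigma) auto
  also have "\<dots> = (\<Sum>(n, r)\<in>(SIGMA n:{..<K}. {..<K - n}). \<Sum>j<M. g n j r)"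
    by (rule sum.reindex_bij_witness[where i = "\<lambda>(n, r). (n + r, n)" and j = "\<lambda>(N, n). (n, N - n)"])
      auto
  also have "\<dots> = (\<Sum>n<K. \<Sum>r<K - n. \<Sum>j<M. g n j r)"
    by (subst sum.Sigma) auto
  also have "\<dots> = (\<Sum>n<K. \<Sum>r<K. \<Sum>j<M. g n j r)"
    by (intro sum.cong refl sum.mono_neutral_left) (auto intro!: sum.neutral g0)
  also have "\<dots> = T"
    unfolding T_def by (intro sum.cong refl sum.swap)
  finally have L: "weyl_act (A * B) p = T" .

  have Bp: "weyl_act B p = (\<Sum>n<K. ?b n * ?d n p)" by (rule weyl_act_bound[OF K])
  obtain L0 where L0: "\<forall>n\<ge>L0. ?d n (weyl_act B p) = 0" using pm_deriv_pow_eventually_0 by blast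
  define L where "L = L0 + K + M"
  have "weyl_act A (weyl_act B p) = (\<Sum>i<L. ?a i * ?d i (weyl_act B p))"
    using L0 by (intro weyl_act_bound) (auto simp: L_def)
  also have "\<dots> = (\<Sum>i<L. \<Sum>n<K. \<Sum>j\<le>i. g n j (i - j))"
  proof (intro sum.cong refl)
    fix i
    have c: "?a i * (of_nat c * q * r) = of_nat c * ?a i * q * r" for c q r
      by (metis mult.assoc mult_of_nat_commute)
    have dd: "?d m (?d n p) = ?d (n + m) p" for m n
      by (metis add.commute comp_apply funpow_add)
    show "?a i * ?d i (weyl_act B p) = (\<Sum>n<K. \<Sum>j\<le>i. g n j (i - j))"
      unfolding Bp pm_deriv_pow_sum pm_leibniz sum_distrib_left c
      by (intro sum.cong refl) (simp add: g_def dd)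
  qed
  also have "\<dots> = (\<Sum>n<K. \<Sum>i<L. \<Sum>j\<le>i. g n j (i - j))"
    by (rule sum.swap)
  also have "\<dots> = T"
    unfolding T_def
  proof (rule sum.cong[OF refl])
    fix n assume n: "n \<in> {..<K}"
    have "(\<Sum>i<L. \<Sum>j\<le>i. g n j (i - j)) = (\<Sum>(i, j)\<in>(SIGMA i:{..<L}. {..i}). g n j (i - j))"
      by (subst sum.Sigma) auto
    also have "\<dots> = (\<Sum>(j, r)\<in>(SIGMA j:{..<L}. {..<L - j}). g n j r)"
      by (rule sum.reindex_bij_witness[where i = "\<lambda>(j, r). (j + r, j)" and j = "\<lambda>(i, j). (j, i - j)"])
        auto
    also have "\<dots> = (\<Sum>(j, r)\<in>{..<M} \<times> {..<K}. g n j r)"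
      using n by (intro sum.mono_neutral_right) (auto simp: L_def not_less intro!: g0)
    finally show "(\<Sum>i<L. \<Sum>j\<le>i. g n j (i - j)) = (\<Sum>j<M. \<Sum>r<K. g n j r)"
      by (simp add: sum.cartesian_product)
  qed
  finally show ?thesis using L by simp
qed

lemma weyl_act_faithful:
  fixes A B :: "'a::rat_algebra_1 weyl"
  assumes "\<And>p. weyl_act A p = weyl_act B p"
  shows "A = B"
proof -
  define C where "C = A - B"
  have C: "weyl_act C p = 0" for p by (simp add: C_def weyl_act_diff assms)
  have "dcoeff C n = 0" for n
  proof (induction n rule: less_induct)
    case (less n)
    let ?p = "Poly_Mapping.single n 1 :: nat \<Rightarrow>\<^sub>0 'a"
    have z: "\<forall>i\<ge>Suc n. (pm_deriv ^^ i) ?p = 0"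
      by (auto intro!: poly_mapping_eqI simp: lookup_pm_deriv_pow lookup_single when_def)
    have f: "(pm_deriv ^^ n) ?p = of_nat (fact n)"
      by (rule poly_mapping_eqI)
        (auto simp: lookup_pm_deriv_pow lookup_single when_def pochhammer_fact of_nat_single
           simp flip: single_of_nat)
    have "0 = (\<Sum>i<Suc n. dcoeff C i * (pm_deriv ^^ i) ?p)"
      using C[of ?p] weyl_act_bound[OF z] by metis
    also have "\<dots> = dcoeff C n * of_nat (fact n)"
      using less f by simp
    also have "\<dots> = of_nat (fact n) * dcoeff C n"
      by (rule mult_of_nat_commute[symmetric])
    finally show ?case
      using of_nat_mult_eq_0_imp[of "fact n" "dcoeff C n"] by simp
  qed
  then have "C = 0" by (intro weyl_eqI) simp
  then show ?thesis by (simp add: C_def)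
qed

lemma weyl_act_add_left: "weyl_act (A + B) p = weyl_act A p + weyl_act B p"
  by (simp add: weyl_act_def distrib_right sum.distrib)

lemma weyl_act_add: "weyl_act A (p + q) = weyl_act A p + weyl_act A q"
proof -
  obtain N M where "\<forall>n\<ge>N. (pm_deriv ^^ n) p = 0" "\<forall>n\<ge>M. (pm_deriv ^^ n) q = 0"
    using pm_deriv_pow_eventually_0 by metis
  then show ?thesis
    by (subst (1 2 3) weyl_act_bound[of "N + M"])
      (auto simp: pm_deriv_pow_add distrib_left sum.distrib)
qed

lemma weyl_act_1: "weyl_act 1 p = p"
proof -
  obtain N where N: "\<forall>n\<ge>N. (pm_deriv ^^ n) p = 0"
    using pm_deriv_pow_eventually_0 by metis
  then have "weyl_act 1 p = (\<Sum>n<Suc N. dcoeff 1 n * (pm_deriv ^^ n) p)"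
    by (intro weyl_act_bound) auto
  also have "\<dots> = p" by (subst sum.lessThan_Suc_shift) (simp add: dcoeff_one)
  finally show ?thesis .
qed

instance weyl :: (rat_algebra_1) ring_1
proof
  fix A B C :: "'a weyl"
  show "A * B * C = A * (B * C)"
    by (rule weyl_act_faithful) (simp add: weyl_act_mult)
  show "(A + B) * C = A * C + B * C"
    by (rule weyl_act_faithful) (simp add: weyl_act_mult weyl_act_add_left)
  show "A * (B + C) = A * B + A * C"
    by (rule weyl_act_faithful) (simp add: weyl_act_mult weyl_act_add_left weyl_act_add)
  show "1 * A = A"
    by (rule weyl_act_faithful) (simp add: weyl_act_mult weyl_act_1)
  show "A * 1 = A"
    by (rule weyl_act_faithful) (simp add: weyl_act_mult weyl_act_1)
  have "dcoeff (0::'a weyl) 0 \<noteq> dcoeff 1 0" by (simp add: dcoeff_one)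
  then show "(0::'a weyl) \<noteq> 1" by metis
qed

definition weyl_of_poly :: "(nat \<Rightarrow>\<^sub>0 'a::zero) \<Rightarrow> 'a weyl" where
  "weyl_of_poly p = Weyl (fps_const p)"

lemma dcoeff_weyl_of_poly: "dcoeff (weyl_of_poly p) n = (if n = 0 then p else 0)"
  by (simp add: dcoeff_def weyl_of_poly_def)

lemma weyl_act_weyl_of_poly: "weyl_act (weyl_of_poly p) q = p * q"
proof -
  obtain N where N: "\<forall>n\<ge>N. (pm_deriv ^^ n) q = 0"
    using pm_deriv_pow_eventually_0 by metis
  then have "weyl_act (weyl_of_poly p) q
      = (\<Sum>n<Suc N. dcoeff (weyl_of_poly p) n * (pm_deriv ^^ n) q)"
    by (intro weyl_act_bound) auto
  also have "\<dots> = p * q" by (subst sum.lessThan_Suc_shift) (simp add: dcoeff_weyl_of_poly)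
  finally show ?thesis .
qed

instantiation weyl :: (rat_algebra_1) rat_algebra_1
begin
definition of_Q_weyl :: "rat \<Rightarrow> 'a weyl" where "of_Q_weyl q = weyl_of_poly (of_Q q)"
instance
proof
  fix p q :: rat
  show "of_Q (1::rat) = (1::'a weyl)"
    by (rule weyl_act_faithful)
      (simp add: of_Q_weyl_def of_Q_1 weyl_act_1 weyl_act_weyl_of_poly)
  show "of_Q (p + q) = (of_Q p + of_Q q :: 'a weyl)"
    by (rule weyl_act_faithful)
      (simp add: of_Q_weyl_def of_Q_add weyl_act_add_left weyl_act_weyl_of_poly distrib_right)
  show "of_Q (p * q) = (of_Q p * of_Q q :: 'a weyl)"
    by (rule weyl_act_faithful)
      (simp add: of_Q_weyl_def of_Q_mult weyl_act_mult weyl_act_weyl_of_poly mult.assoc)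
qed
end

definition weyl_x :: "'a::semiring_1 weyl" where
  "weyl_x = weyl_of_poly poly_x"

text \<open>The element \<open>f(d/dx)\<close> for a rational power series \<open>f\<close>.\<close>

definition weyl_of_rat_fps :: "rat fps \<Rightarrow> 'a::rat_algebra_1 weyl" where
  "weyl_of_rat_fps f = Weyl (Abs_fps (\<lambda>n. of_Q (fps_nth f n)))"

definition weyl_D :: "'a::rat_algebra_1 weyl" where
  "weyl_D = weyl_of_rat_fps fps_X"

lemma dcoeff_weyl_of_rat_fps: "dcoeff (weyl_of_rat_fps f) n = of_Q (fps_nth f n)"
  by (simp add: dcoeff_def weyl_of_rat_fps_def)

lemma weyl_act_x: "weyl_act weyl_x p = poly_x * p"
  by (simp add: weyl_x_def weyl_act_weyl_of_poly)

lemma weyl_act_D: "weyl_act weyl_D p = pm_deriv p"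
proof -
  obtain N where N: "\<forall>n\<ge>N. (pm_deriv ^^ n) p = 0"
    using pm_deriv_pow_eventually_0 by metis
  have "weyl_act weyl_D p = (\<Sum>n<Suc (Suc N). dcoeff weyl_D n * (pm_deriv ^^ n) p)"
    using N by (intro weyl_act_bound) auto
  also have "\<dots> = pm_deriv p"
    by (subst sum.lessThan_Suc_shift, subst sum.lessThan_Suc_shift)
      (simp add: weyl_D_def dcoeff_weyl_of_rat_fps of_Q_0 of_Q_1)
  finally show ?thesis .
qed

lemma weyl_commutator: "weyl_D * weyl_x - weyl_x * weyl_D = (1 :: 'a::rat_algebra_1 weyl)"
  by (rule weyl_act_faithful)
    (simp add: weyl_act_diff weyl_act_mult weyl_act_x weyl_act_D weyl_act_1 pm_deriv_mult)


section \<open>Power series in \<open>\<lambda>\<close> and \<open>k\<close>\<close>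

text \<open>
  \<open>B[[\<lambda>, k]]\<close> is the type \<open>'b fps fps\<close>, the outer variable being \<open>\<lambda>\<close> and the inner one \<open>k\<close>.
  Both commute with \<open>B\<close>, which may be noncommutative.
\<close>

definition ser_const :: "'b::zero \<Rightarrow> 'b fps fps" where
  "ser_const b = fps_const (fps_const b)"

definition ser_lambda :: "'b::{zero,one} fps fps" where
  "ser_lambda = fps_X"

definition ser_k :: "'b::{zero,one} fps fps" where
  "ser_k = fps_const fps_X"

text \<open>The extension of the action to \<open>R[x][[\<lambda>, k]]\<close> that is linear and continuous in \<open>\<lambda>, k\<close>.\<close>

definition ser_act ::
  "'a::ring_1 weyl fps fps \<Rightarrow> (nat \<Rightarrow>\<^sub>0 'a) fps fps \<Rightarrow> (nat \<Rightarrow>\<^sub>0 'a) fps fps" where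
  "ser_act A P = Abs_fps (\<lambda>i. Abs_fps (\<lambda>j. \<Sum>r\<le>i. \<Sum>s\<le>j.
     weyl_act (fps_nth (fps_nth A r) s) (fps_nth (fps_nth P (i - r)) (j - s))))"

text \<open>
  A rational series \<open>\<alpha>(\<lambda>, t)\<close> is an element of \<open>rat fps fps\<close> with outer variable \<open>\<lambda>\<close>; here \<open>t\<close> is
  replaced by \<open>d/dx\<close>, respectively by \<open>k\<close>.
\<close>

definition subst_D :: "rat fps fps \<Rightarrow> 'a::rat_algebra_1 weyl fps fps" where
  "subst_D \<alpha> = Abs_fps (\<lambda>i. fps_const (weyl_of_rat_fps (fps_nth \<alpha> i)))"

definition subst_k :: "rat fps fps \<Rightarrow> 'b::rat_algebra_1 fps fps" where
  "subst_k \<alpha> = Abs_fps (\<lambda>i. Abs_fps (\<lambda>j. of_Q (fps_nth (fps_nth \<alpha> i) j)))"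


section \<open>Infinite sums and exponentials\<close>

text \<open>
  Infinite sums are taken coefficientwise, each coefficient receiving only finitely many nonzero
  contributions.  This is convergence in the product topology over discrete coefficients,
  which the metric of \<^typ>\<open>'b fps\<close> does not give for iterated series.  For series over the
  completed Weyl algebra the coefficients are those of the \<open>\<lambda>\<^sup>i k\<^sup>j D\<^sup>n\<close>, which lie in \<open>R[x]\<close>: two
  elements are close if they agree modulo a power of \<open>D\<close> on the right.
\<close>

definition formal_sums ::
  "('i \<Rightarrow> 'b \<Rightarrow> 'c::comm_monoid_add) \<Rightarrow> (nat \<Rightarrow> 'b) \<Rightarrow> 'b \<Rightarrow> bool" where
  "formal_sums c f S \<longleftrightarrow>
     (\<forall>\<iota>. finite {s. c \<iota> (f s) \<noteq> 0} \<and> c \<iota> S = (\<Sum>s | c \<iota> (f s) \<noteq> 0. c \<iota> (f s)))"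

definition formal_summable ::
  "('i \<Rightarrow> 'b \<Rightarrow> 'c::comm_monoid_add) \<Rightarrow> (nat \<Rightarrow> 'b) \<Rightarrow> bool" where
  "formal_summable c f \<longleftrightarrow> (\<exists>S. formal_sums c f S)"

definition formal_suminf ::
  "('i \<Rightarrow> 'b \<Rightarrow> 'c::comm_monoid_add) \<Rightarrow> (nat \<Rightarrow> 'b) \<Rightarrow> 'b" where
  "formal_suminf c f = (THE S. formal_sums c f S)"

definition weyl_coeff :: "nat \<times> nat \<times> nat \<Rightarrow> 'a::zero weyl fps fps \<Rightarrow> (nat \<Rightarrow>\<^sub>0 'a)" where
  "weyl_coeff = (\<lambda>(i, j, n) A. dcoeff (fps_nth (fps_nth A i) j) n)"

definition poly_coeff :: "nat \<times> nat \<Rightarrow> (nat \<Rightarrow>\<^sub>0 'a::zero) fps fps \<Rightarrow> (nat \<Rightarrow>\<^sub>0 'a)" where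
  "poly_coeff = (\<lambda>(i, j) P. fps_nth (fps_nth P i) j)"

lemma formal_suminf_weyl_coeff:
  "formal_sums weyl_coeff f S \<Longrightarrow> formal_suminf weyl_coeff f = S"
  unfolding formal_suminf_def
proof (rule the_equality)
  fix S' assume "formal_sums weyl_coeff f S" "formal_sums weyl_coeff f S'"
  then have "weyl_coeff (i, j, n) S' = weyl_coeff (i, j, n) S" for i j n
    by (simp add: formal_sums_def)
  then show "S' = S" by (intro fps_ext weyl_eqI) (simp add: weyl_coeff_def)
qed

lemma formal_suminf_poly_coeff:
  "formal_sums poly_coeff f S \<Longrightarrow> formal_suminf poly_coeff f = S"
  unfolding formal_suminf_def
proof (rule the_equality)
  fix S' assume "formal_sums poly_coeff f S" "formal_sums poly_coeff f S'"
  then have "poly_coeff (i, j) S' = poly_coeff (i, j) S" for i j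
    by (simp add: formal_sums_def)
  then show "S' = S" by (intro fps_ext) (simp add: poly_coeff_def)
qed

definition exp_term :: "'b::rat_algebra_1 \<Rightarrow> nat \<Rightarrow> 'b" where
  "exp_term a s = of_Q (1 / fact s) * a ^ s"

definition formal_exp ::
  "('i \<Rightarrow> 'b::rat_algebra_1 \<Rightarrow> 'c::comm_monoid_add) \<Rightarrow> 'b \<Rightarrow> 'b" where
  "formal_exp c a = formal_suminf c (exp_term a)"

text \<open>The terms \<open>x\<^sup>s \<alpha>\<^sup>s / s!\<close> of the normally ordered exponential.\<close>

definition normal_exp_term :: "rat fps fps \<Rightarrow> nat \<Rightarrow> 'a::rat_algebra_1 weyl fps fps" where
  "normal_exp_term \<alpha> s = of_Q (1 / fact s) * (ser_const weyl_x ^ s * subst_D \<alpha> ^ s)"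

definition lambda_x_F :: "rat fps \<Rightarrow> 'a::rat_algebra_1 weyl fps fps" where
  "lambda_x_F F = ser_lambda * ser_const weyl_x * ser_const (weyl_of_rat_fps F)"

definition normal_exp_eq :: "'a::rat_algebra_1 itself \<Rightarrow> rat fps \<Rightarrow> rat fps fps \<Rightarrow> bool" where
  "normal_exp_eq _ F \<alpha> \<longleftrightarrow>
     formal_summable weyl_coeff (normal_exp_term \<alpha> :: nat \<Rightarrow> 'a weyl fps fps) \<and>
     formal_exp weyl_coeff (lambda_x_F F :: 'a weyl fps fps)
       = formal_suminf weyl_coeff (normal_exp_term \<alpha>)"

end

theory Submission
  imports Defs
begin

text \<open>
  Let \<open>\<alpha>\<close> solve \<open>\<partial>\<alpha>/\<partial>\<lambda> = (1 + \<partial>\<alpha>/\<partial>D) F\<close> with \<open>\<alpha> = 0\<close> at \<open>\<lambda> = 0\<close>, which determines its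
  \<open>\<lambda>\<close>-coefficients recursively, and put \<open>E = \<Sum>s. x\<^sup>s \<alpha>\<^sup>s / s!\<close>.  Since \<open>f(D) x = x f(D) + f'(D)\<close>,
  multiplication by \<open>x\<close> on the right gives \<open>E x = x E (1 + \<partial>\<alpha>/\<partial>D)\<close>, hence
  \<open>E x F = x E \<partial>\<alpha>/\<partial>\<lambda> = \<partial>E/\<partial>\<lambda>\<close>, and so \<open>E = exp(\<lambda>xF)\<close>.  Multiplying on the right rather than on
  the left keeps the equation first order and thus solvable by a single exponential.

  Uniqueness holds because the part of \<open>E\<close> linear in \<open>x\<close> is \<open>x \<alpha>\<close>.  For the second identity,
  \<open>exp(kx)\<close> is an eigenvector of \<open>D\<close> with eigenvalue \<open>k\<close>, so a normally ordered series acts on it by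
  substituting \<open>k\<close> for \<open>D\<close>; on coefficients this is the binomial theorem for \<open>(\<alpha> + k)\<^sup>t\<close>.
\<close>

unbundle fps_syntax

section \<open>Rational scalars\<close>

lemma of_Q_of_int: "of_Q (of_int z) = of_int z"
proof (cases z rule: int_cases2)
  case (nonneg n)
  then show ?thesis by (simp add: of_Q_of_nat)
next
  case (nonpos n)
  have "of_Q (- of_nat n) + (of_nat n :: 'a) = 0"
    by (simp only: of_Q_0 left_minus flip: of_Q_add of_Q_of_nat[where 'a = 'a])
  then have "of_Q (- of_nat n) = (- of_nat n :: 'a)"
    by (simp only: eq_neg_iff_add_eq_0)
  with nonpos show ?thesis by simp
qed

text \<open>With \<open>q = z / n\<close>, the element \<open>of_nat n * of_Q q\<close> is an
  integer and hence central; the factor \<open>n\<close> cancels because multiplication by a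
  positive integer is injective.\<close>

lemma of_Q_commute: "of_Q q * b = b * of_Q q"
proof -
  obtain z m where q: "q = of_int z / of_int m" and m: "m > 0"
    by (cases q) (auto simp: Fract_of_int_quotient)
  define n where "n = nat m"
  have n: "n > 0" "of_int m = (of_nat n :: rat)" using m by (simp_all add: n_def)
  have "of_nat n * (of_Q q :: 'a) = of_Q (of_nat n * q)"
    by (simp add: of_Q_mult of_Q_of_nat)
  also have "\<dots> = of_int z" using n by (simp add: q of_Q_of_int)
  finally have *: "of_nat n * (of_Q q :: 'a) = of_int z" .
  have "of_nat n * (of_Q q * b - b * of_Q q)
      = of_nat n * of_Q q * b - b * (of_nat n * of_Q q)"
    by (simp add: right_diff_distrib mult.assoc)
      (metis mult.assoc mult_of_nat_commute)
  also have "\<dots> = 0" by (simp add: * mult_of_int_commute)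
  finally have "of_nat n * (of_Q q * b - b * of_Q q) = 0" .
  from of_nat_mult_eq_0_imp[OF this n(1)] show ?thesis by simp
qed

lemma of_Q_eq_0_iff: "of_Q q = (0 :: 'a::rat_algebra_1) \<longleftrightarrow> q = 0"
proof
  assume *: "of_Q q = (0 :: 'a)"
  show "q = 0"
  proof (rule ccontr)
    assume "q \<noteq> 0"
    then have "of_Q q * of_Q (inverse q) = (1 :: 'a)"
      by (simp add: of_Q_1 flip: of_Q_mult)
    then show False using * by simp
  qed
qed (simp add: of_Q_0)

lemma of_Q_inject: "of_Q p = (of_Q q :: 'a::rat_algebra_1) \<longleftrightarrow> p = q"
proof -
  have "of_Q p = of_Q (p - q) + (of_Q q :: 'a)" by (simp flip: of_Q_add)
  then show ?thesis using of_Q_eq_0_iff[of "p - q", where 'a = 'a] by auto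
qed

lemma of_Q_sum: "of_Q (\<Sum>i\<in>I. f i) = (\<Sum>i\<in>I. of_Q (f i))"
  by (induction I rule: infinite_finite_induct) (simp_all add: of_Q_0 of_Q_add)

lemma of_Q_pm: "(of_Q q :: nat \<Rightarrow>\<^sub>0 'a::rat_algebra_1) = Poly_Mapping.single 0 (of_Q q)"
  by (simp add: of_Q_poly_mapping_def)

lemma pm_deriv_of_Q [simp]: "pm_deriv (of_Q q) = 0"
  by (simp add: of_Q_pm pm_deriv_single)

lemma poly_x_power: "poly_x ^ s = Poly_Mapping.single s 1"
  by (induction s) (simp_all add: poly_x_def mult_single)

lemma single_of_Q_sum:
  "Poly_Mapping.single m (of_Q (\<Sum>i\<in>I. f i)) = (\<Sum>i\<in>I. Poly_Mapping.single m (of_Q (f i)))"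
  by (induction I rule: infinite_finite_induct) (simp_all add: of_Q_0 of_Q_add single_add)


section \<open>Normally ordered products\<close>

text \<open>A polynomial has only a coefficient at \<open>D^0\<close>, so
  \<open>n - m + j = 0\<close> is forced, that is \<open>m = n\<close> and \<open>j = 0\<close>: on
  the left it meets no \<open>D\<close> to pass.\<close>

lemma dcoeff_weyl_of_poly_mult: "dcoeff (weyl_of_poly p * A) n = p * dcoeff A n"
proof -
  have "dcoeff (weyl_of_poly p * A) n = (\<Sum>m\<le>n. if m = n then p * dcoeff A n else 0)"
    unfolding dcoeff_mult
  proof (rule sum.cong[OF refl])
    fix m assume m: "m \<in> {..n}"
    let ?J = "{j. (pm_deriv ^^ j) (dcoeff A m) \<noteq> 0}"
    have "(\<Sum>j\<in>?J. of_nat ((n - m + j) choose j) * dcoeff (weyl_of_poly p) (n - m + j)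
          * (pm_deriv ^^ j) (dcoeff A m))
        = (\<Sum>j\<in>?J. if j = 0 then if m = n then p * dcoeff A n else 0 else 0)"
      using m by (intro sum.cong refl) (auto simp: dcoeff_weyl_of_poly)
    \<comment> \<open>If \<open>dcoeff A m = 0\<close>, the index set is empty and does not contain
      \<open>0\<close>, but then the right-hand side vanishes too.\<close>
    also have "\<dots> = (if m = n then p * dcoeff A n else 0)"
      using finite_pm_deriv_pow[of "dcoeff A m"] by (subst sum.delta) auto
    finally show "(\<Sum>j\<in>?J. of_nat ((n - m + j) choose j) * dcoeff (weyl_of_poly p) (n - m + j)
          * (pm_deriv ^^ j) (dcoeff A m)) = (if m = n then p * dcoeff A n else 0)" .
  qed
  then show ?thesis by simp
qed

lemma weyl_of_poly_mult:
  "weyl_of_poly p * weyl_of_poly q = weyl_of_poly (p * q :: nat \<Rightarrow>\<^sub>0 'a::ring_1)"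
  by (rule weyl_eqI) (simp add: dcoeff_weyl_of_poly_mult dcoeff_weyl_of_poly)

lemma weyl_x_power: "weyl_x ^ s = weyl_of_poly (poly_x ^ s :: nat \<Rightarrow>\<^sub>0 'a::rat_algebra_1)"
proof (induction s)
  case 0
  show ?case by (rule weyl_eqI) (simp add: dcoeff_one dcoeff_weyl_of_poly)
qed (simp add: weyl_x_def weyl_of_poly_mult)

lemma weyl_of_rat_fps_0 [simp]: "weyl_of_rat_fps 0 = 0"
  by (rule weyl_eqI) (simp add: dcoeff_weyl_of_rat_fps of_Q_0)

lemma weyl_of_rat_fps_1: "weyl_of_rat_fps 1 = 1"
  by (rule weyl_eqI) (simp add: dcoeff_weyl_of_rat_fps of_Q_0 of_Q_1 dcoeff_one)

lemma weyl_of_rat_fps_add: "weyl_of_rat_fps (f + g) = weyl_of_rat_fps f + weyl_of_rat_fps g"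
  by (rule weyl_eqI) (simp add: dcoeff_weyl_of_rat_fps of_Q_add)

lemma weyl_of_rat_fps_sum:
  "weyl_of_rat_fps (\<Sum>i\<in>I. f i) = (\<Sum>i\<in>I. weyl_of_rat_fps (f i))"
  by (induction I rule: infinite_finite_induct) (simp_all add: weyl_of_rat_fps_add)

text \<open>The coefficients are constants in \<open>x\<close>, so all terms with
  \<open>j \<ge> 1\<close> vanish and the Weyl product becomes the Cauchy product.\<close>

lemma weyl_of_rat_fps_mult:
  "weyl_of_rat_fps (f * g) = weyl_of_rat_fps f * (weyl_of_rat_fps g :: 'a::rat_algebra_1 weyl)"
proof (rule weyl_eqI)
  fix N
  let ?b = "\<lambda>n. of_Q (g $ n) :: nat \<Rightarrow>\<^sub>0 'a"
  have "dcoeff (weyl_of_rat_fps f * weyl_of_rat_fps g :: 'a weyl) N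
      = (\<Sum>n\<le>N. of_Q (f $ (N - n)) * ?b n)"
    unfolding dcoeff_mult dcoeff_weyl_of_rat_fps
  proof (rule sum.cong[OF refl])
    fix n
    have z: "\<forall>j\<ge>1. (pm_deriv ^^ j) (?b n) = 0"
      by (metis One_nat_def Suc_le_D funpow_Suc_right o_apply pm_deriv_of_Q pm_deriv_pow_0)
    show "(\<Sum>j | (pm_deriv ^^ j) (?b n) \<noteq> 0. of_nat ((N - n + j) choose j)
        * of_Q (f $ (N - n + j)) * (pm_deriv ^^ j) (?b n)) = of_Q (f $ (N - n)) * ?b n"
      by (subst sum_pm_deriv_bound[OF z]) simp_all
  qed
  also have "\<dots> = of_Q (\<Sum>n\<le>N. f $ (N - n) * g $ n)"
    by (simp add: of_Q_sum of_Q_mult)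
  also have "(\<Sum>n\<le>N. f $ (N - n) * g $ n) = (g * f) $ N"
    by (simp only: fps_mult_nth atLeast0AtMost mult.commute[of "f $ _"])
  finally show "dcoeff (weyl_of_rat_fps (f * g)) N
      = dcoeff (weyl_of_rat_fps f * weyl_of_rat_fps g :: 'a weyl) N"
    by (simp add: dcoeff_weyl_of_rat_fps mult.commute)
qed

lemma weyl_of_rat_fps_const: "weyl_of_rat_fps (fps_const q) = of_Q q"
  by (rule weyl_eqI) (simp add: dcoeff_weyl_of_rat_fps of_Q_weyl_def dcoeff_weyl_of_poly of_Q_0)

text \<open>As \<open>x\<close> has zero second derivative, only \<open>j = 0\<close> and
  \<open>j = 1\<close> survive; for \<open>j = 1\<close> the binomial coefficient is
  \<open>N + 1\<close>, the factor that differentiation of \<open>f\<close> produces.\<close>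

lemma weyl_of_rat_fps_mult_x:
  "weyl_of_rat_fps f * weyl_x
     = weyl_x * weyl_of_rat_fps f + (weyl_of_rat_fps (fps_deriv f) :: 'a::rat_algebra_1 weyl)"
proof (rule weyl_eqI)
  fix N
  let ?X = "\<lambda>n. dcoeff (weyl_x :: 'a weyl) n"
  let ?t = "\<lambda>n j. of_nat ((N - n + j) choose j) * of_Q (f $ (N - n + j)) * (pm_deriv ^^ j) (?X n)"
  have X: "?X n = (if n = 0 then poly_x else 0)" for n
    by (simp add: weyl_x_def dcoeff_weyl_of_poly)
  have z: "\<forall>j\<ge>2. (pm_deriv ^^ j) (poly_x :: nat \<Rightarrow>\<^sub>0 'a) = 0"
  proof (intro allI impI)
    fix j :: nat assume "j \<ge> 2"
    then obtain i where "j = i + 2" by (metis add.commute le_Suc_ex)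
    then show "(pm_deriv ^^ j) (poly_x :: nat \<Rightarrow>\<^sub>0 'a) = 0"
      by (simp only: funpow_add o_apply) (simp add: numeral_2_eq_2)
  qed
  have "dcoeff (weyl_of_rat_fps f * weyl_x :: 'a weyl) N
      = (\<Sum>n\<le>N. \<Sum>j | (pm_deriv ^^ j) (?X n) \<noteq> 0. ?t n j)"
    by (simp only: dcoeff_mult dcoeff_weyl_of_rat_fps)
  also have "\<dots> = (\<Sum>n\<in>{0}. \<Sum>j | (pm_deriv ^^ j) (?X n) \<noteq> 0. ?t n j)"
    by (rule sum.mono_neutral_right) (auto simp: X)
  also have "\<dots> = (\<Sum>j<2. ?t 0 j)"
    using z by (simp add: X sum_pm_deriv_bound)
  also have "\<dots> = of_Q (f $ N) * poly_x + of_nat (Suc N) * of_Q (f $ Suc N)"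
    by (simp add: X numeral_2_eq_2)
  also have "\<dots> = poly_x * of_Q (f $ N) + of_Q (of_nat (Suc N) * f $ Suc N)"
    by (simp only: of_Q_mult of_Q_of_nat of_Q_commute[of _ poly_x])
  also have "\<dots> = dcoeff (weyl_x * weyl_of_rat_fps f + weyl_of_rat_fps (fps_deriv f) :: 'a weyl) N"
    by (simp add: weyl_x_def dcoeff_weyl_of_poly_mult dcoeff_weyl_of_rat_fps)
  finally show "dcoeff (weyl_of_rat_fps f * weyl_x :: 'a weyl) N
      = dcoeff (weyl_x * weyl_of_rat_fps f + weyl_of_rat_fps (fps_deriv f) :: 'a weyl) N" .
qed


section \<open>The exponentials as explicit series\<close>

text \<open>The exact support of the terms is awkward to compute; a finite superset
  \<open>T \<iota>\<close> gives the same sum.\<close>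

lemma formal_sumsI:
  assumes "\<And>\<iota>. finite (T \<iota>)" "\<And>\<iota> s. s \<notin> T \<iota> \<Longrightarrow> c \<iota> (f s) = 0"
    "\<And>\<iota>. c \<iota> S = (\<Sum>s\<in>T \<iota>. c \<iota> (f s))"
  shows "formal_sums c f S"
  unfolding formal_sums_def
proof
  fix \<iota>
  have sub: "{s. c \<iota> (f s) \<noteq> 0} \<subseteq> T \<iota>" using assms(2) by blast
  show "finite {s. c \<iota> (f s) \<noteq> 0} \<and> c \<iota> S = (\<Sum>s | c \<iota> (f s) \<noteq> 0. c \<iota> (f s))"
    using finite_subset[OF sub] assms(1,3) sum.mono_neutral_left[OF assms(1) sub, of "\<lambda>s. c \<iota> (f s)"]
    by auto
qed

lemma dcoeff_sum: "dcoeff (\<Sum>i\<in>I. f i) n = (\<Sum>i\<in>I. dcoeff (f i) n)"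
  by (induction I rule: infinite_finite_induct) simp_all

lemma lambda_x_F_power:
  "lambda_x_F F ^ s $ i $ j
     = (if i = s \<and> j = 0 then (weyl_x * weyl_of_rat_fps F) ^ s else (0 :: 'a::rat_algebra_1 weyl))"
proof -
  have "lambda_x_F F ^ s
      = fps_X ^ s * fps_const (fps_const ((weyl_x * weyl_of_rat_fps F :: 'a weyl) ^ s))"
    (is "_ = fps_X ^ s * ?c (?y ^ s)")
  proof (induction s)
    case (Suc s)
    have "lambda_x_F F ^ Suc s = fps_X * ?c ?y * (fps_X ^ s * ?c (?y ^ s))"
      unfolding power_Suc Suc by (simp add: lambda_x_F_def ser_lambda_def ser_const_def mult.assoc)
    also have "\<dots> = fps_X ^ Suc s * (?c ?y * ?c (?y ^ s))"
      by (metis (no_types, lifting) fps_mult_fps_X_power_commute mult.assoc power_Suc)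
    finally show ?case by simp
  qed simp
  then show ?thesis by (auto simp: fps_X_power_mult_nth)
qed

lemma formal_sums_exp_lambda_x_F:
  "formal_sums weyl_coeff (exp_term (lambda_x_F F))
     (Abs_fps (\<lambda>i. fps_const
       (of_Q (1 / fact i) * (weyl_x * weyl_of_rat_fps F :: 'a::rat_algebra_1 weyl) ^ i)))"
\<comment> \<open>The \<open>s\<close>-th power is homogeneous of degree \<open>s\<close> in
  \<open>\<lambda>\<close>, so the coefficient at \<open>\<lambda>^i\<close> sees only
  \<open>s = i\<close>.\<close>
proof (rule formal_sumsI[where T = "\<lambda>(i, j, n). {i}"])
  fix \<iota> :: "nat \<times> nat \<times> nat"
  show "finite (case \<iota> of (i, j, n) \<Rightarrow> {i})" by (cases \<iota>) simp
next
  fix \<iota> :: "nat \<times> nat \<times> nat" and s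
  assume "s \<notin> (case \<iota> of (i, j, n) \<Rightarrow> {i})"
  then show "weyl_coeff \<iota> (exp_term (lambda_x_F F) s :: 'a weyl fps fps) = 0"
    by (cases \<iota>) (simp add: weyl_coeff_def exp_term_def of_Q_fps_def lambda_x_F_power)
qed (auto simp: weyl_coeff_def exp_term_def of_Q_fps_def lambda_x_F_power)

lemma subst_D_power:
  "(subst_D \<alpha> :: 'a::rat_algebra_1 weyl fps fps) ^ s
     = Abs_fps (\<lambda>i. fps_const (weyl_of_rat_fps (\<alpha> ^ s $ i)))"
proof (induction s)
  case 0
  show ?case by (intro fps_ext) (simp add: weyl_of_rat_fps_1)
next
  case (Suc s)
  show ?case unfolding power_Suc Suc
    by (intro fps_ext)
      (simp add: subst_D_def fps_mult_nth fps_sum_nth weyl_of_rat_fps_sum weyl_of_rat_fps_mult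
        if_distrib cong: if_cong)
qed

lemma normal_exp_term_nth:
  "normal_exp_term \<alpha> s $ i $ j
     = (if j = 0 then of_Q (1 / fact s) * (weyl_x ^ s * weyl_of_rat_fps (\<alpha> ^ s $ i))
        else (0 :: 'a::rat_algebra_1 weyl))"
proof -
  have "(ser_const weyl_x :: 'a weyl fps fps) ^ s = fps_const (fps_const (weyl_x ^ s))"
    by (simp add: ser_const_def fps_const_power)
  then show ?thesis
    by (simp add: normal_exp_term_def subst_D_power of_Q_fps_def)
qed

text \<open>Normal ordering makes every \<open>D\<close>-coefficient a multiple of
  \<open>x^s\<close>, so different \<open>s\<close> never mix in the normally ordered
  exponential.\<close>

lemma dcoeff_normal_term:
  "dcoeff (of_Q q * (weyl_x ^ s * weyl_of_rat_fps f)) n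
     = Poly_Mapping.single s (of_Q (q * f $ n) :: 'a::rat_algebra_1)"
  by (simp add: of_Q_weyl_def weyl_x_power dcoeff_weyl_of_poly_mult dcoeff_weyl_of_rat_fps
      poly_x_power of_Q_pm mult_single of_Q_mult)

lemma weyl_coeff_normal_exp_term:
  "weyl_coeff (i, j, n) (normal_exp_term \<alpha> s)
     = (if j = 0 then Poly_Mapping.single s (of_Q (1 / fact s * \<alpha> ^ s $ i $ n) :: 'a::rat_algebra_1)
        else 0)"
  by (simp add: weyl_coeff_def normal_exp_term_nth dcoeff_normal_term)

text \<open>Since \<open>\<lambda>\<close> divides \<open>\<alpha>\<close>,
  \<open>\<lambda>^s\<close> divides \<open>\<alpha> ^ s\<close>, which bounds the contributing
  terms by \<open>s \<le> i\<close>.\<close>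

lemma formal_sums_normal_exp:
  assumes "\<alpha> $ 0 = 0"
  shows "formal_sums weyl_coeff (normal_exp_term \<alpha>)
    (Abs_fps (\<lambda>i. fps_const (\<Sum>s\<le>i. of_Q (1 / fact s)
       * (weyl_x ^ s * weyl_of_rat_fps (\<alpha> ^ s $ i)) :: 'a::rat_algebra_1 weyl)))"
proof (rule formal_sumsI[where T = "\<lambda>(i, j, n). {..i}"])
  fix \<iota> :: "nat \<times> nat \<times> nat"
  show "finite (case \<iota> of (i, j, n) \<Rightarrow> {..i})" by (cases \<iota>) simp
next
  fix \<iota> :: "nat \<times> nat \<times> nat" and s
  assume "s \<notin> (case \<iota> of (i, j, n) \<Rightarrow> {..i})"
  then show "weyl_coeff \<iota> (normal_exp_term \<alpha> s :: 'a weyl fps fps) = 0"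
    using startsby_zero_power_prefix[OF assms, of s]
    by (cases \<iota>) (simp add: weyl_coeff_normal_exp_term of_Q_0)
qed (auto simp: weyl_coeff_def normal_exp_term_nth dcoeff_sum)

section \<open>Uniqueness of the exponent\<close>

lemma formal_sums_normal_exp_linear:
  assumes "formal_sums weyl_coeff (normal_exp_term \<alpha>) (S :: 'a::rat_algebra_1 weyl fps fps)"
  shows "Poly_Mapping.lookup (weyl_coeff (i, 0, n) S) 1 = of_Q (\<alpha> $ i $ n)"
proof -
  let ?t = "\<lambda>s. weyl_coeff (i, 0, n) (normal_exp_term \<alpha> s :: 'a weyl fps fps)"
  have fin: "finite {s. ?t s \<noteq> 0}" and S: "weyl_coeff (i, 0, n) S = (\<Sum>s | ?t s \<noteq> 0. ?t s)"
    using assms by (auto simp: formal_sums_def)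
  have t: "Poly_Mapping.lookup (?t s) 1 = (if s = 1 then of_Q (\<alpha> $ i $ n) else 0)" for s
    by (simp add: weyl_coeff_normal_exp_term lookup_single when_def)
  have "Poly_Mapping.lookup (weyl_coeff (i, 0, n) S) 1
      = (\<Sum>s | ?t s \<noteq> 0. if s = 1 then of_Q (\<alpha> $ i $ n) else 0)"
    unfolding S lookup_sum t ..
  also have "\<dots> = (if ?t 1 \<noteq> 0 then of_Q (\<alpha> $ i $ n) else 0)"
    using fin by (subst sum.delta) auto
  \<comment> \<open>If \<open>?t 1 = 0\<close>, then its coefficient at \<open>x\<close>, which is
    \<open>of_Q (\<alpha> $ i $ n)\<close>, is zero as well.\<close>
  also have "\<dots> = of_Q (\<alpha> $ i $ n)"
    using t[of 1] by auto
  finally show ?thesis .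
qed

lemma normal_exp_eq_unique:
  assumes "normal_exp_eq TYPE('a::rat_algebra_1) F \<alpha>" "normal_exp_eq TYPE('a) F \<beta>"
  shows "\<alpha> = \<beta>"
proof -
  let ?E = "formal_exp weyl_coeff (lambda_x_F F :: 'a weyl fps fps)"
  \<comment> \<open>Summability ensures that the definite description in
    \<open>formal_suminf\<close> denotes a genuine sum, so both exponents sum to the same
    \<open>?E\<close>.\<close>
  have E: "formal_sums weyl_coeff (normal_exp_term \<gamma>) ?E" if "normal_exp_eq TYPE('a) F \<gamma>" for \<gamma>
    using that unfolding normal_exp_eq_def formal_summable_def
    by (metis formal_suminf_weyl_coeff)
  have "of_Q (\<alpha> $ i $ n) = (of_Q (\<beta> $ i $ n) :: 'a)" for i n
    using formal_sums_normal_exp_linear[OF E[OF assms(1)]]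
      formal_sums_normal_exp_linear[OF E[OF assms(2)]] by metis
  then show ?thesis by (intro fps_ext) (simp add: of_Q_inject)
qed


section \<open>The normally ordered exponent\<close>

text \<open>Comparison of the coefficients of \<open>\<lambda>^i\<close> in the differential
  equation; the constant \<open>1\<close> there contributes only for \<open>i = 0\<close>, so the
  first nontrivial coefficient is \<open>F\<close>.\<close>

primrec normal_exponent_coeff :: "rat fps \<Rightarrow> nat \<Rightarrow> rat fps" where
  "normal_exponent_coeff F 0 = 0"
| "normal_exponent_coeff F (Suc i) = fps_const (1 / of_nat (Suc i))
     * (F * (fps_deriv (normal_exponent_coeff F i) + (if i = 0 then 1 else 0)))"

definition normal_exponent :: "rat fps \<Rightarrow> rat fps fps" where
  "normal_exponent F = Abs_fps (normal_exponent_coeff F)"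

text \<open>This is \<open>\<partial>/\<partial>D\<close>, whereas \<open>fps_deriv\<close> on
  \<open>rat fps fps\<close> is \<open>\<partial>/\<partial>\<lambda>\<close>.\<close>

definition inner_deriv :: "rat fps fps \<Rightarrow> rat fps fps" where
  "inner_deriv \<alpha> = Abs_fps (\<lambda>i. fps_deriv (\<alpha> $ i))"

lemma normal_exponent_nth_0 [simp]: "normal_exponent F $ 0 = 0"
  by (simp add: normal_exponent_def)

lemma normal_exponent_ode:
  "fps_deriv (normal_exponent F) = (1 + inner_deriv (normal_exponent F)) * fps_const F"
proof (rule fps_ext)
  fix i
  have "(of_nat (Suc i) :: rat fps) * fps_const (1 / of_nat (Suc i)) = 1"
    by (simp del: of_nat_Suc flip: fps_of_nat)
  then have cancel: "of_nat (Suc i) * (fps_const (1 / of_nat (Suc i)) * g) = g" for g :: "rat fps"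
    by (metis mult.assoc mult_1)
  have "fps_deriv (normal_exponent F) $ i = of_nat (Suc i) * normal_exponent_coeff F (Suc i)"
    by (simp only: fps_deriv_nth normal_exponent_def fps_nth_Abs_fps Suc_eq_plus1)
  also have "\<dots> = F * (fps_deriv (normal_exponent_coeff F i) + (if i = 0 then 1 else 0))"
    by (simp only: normal_exponent_coeff.simps cancel)
  also have "\<dots> = ((1 + inner_deriv (normal_exponent F)) * fps_const F) $ i"
    by (simp add: normal_exponent_def inner_deriv_def algebra_simps)
  finally show "fps_deriv (normal_exponent F) $ i
      = ((1 + inner_deriv (normal_exponent F)) * fps_const F) $ i" .
qed

lemma inner_deriv_mult: "inner_deriv (\<alpha> * \<beta>) = inner_deriv \<alpha> * \<beta> + \<alpha> * inner_deriv \<beta>"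
  by (rule fps_ext) (simp add: inner_deriv_def fps_mult_nth fps_deriv_sum sum.distrib add.commute)

lemma inner_deriv_power: "inner_deriv (\<alpha> ^ Suc s) = of_nat (Suc s) * (\<alpha> ^ s * inner_deriv \<alpha>)"
proof (induction s)
  case (Suc s)
  show ?case
    by (subst power_Suc, subst inner_deriv_mult, subst Suc) (simp add: algebra_simps)
qed simp

lemma fps_deriv_power_Suc:
  "fps_deriv (\<alpha> ^ Suc s) = of_nat (Suc s) * (\<alpha> ^ s * fps_deriv (\<alpha> :: rat fps fps))"
proof (induction s)
  case (Suc s)
  show ?case
    by (subst power_Suc, subst fps_deriv_mult, subst Suc) (simp add: algebra_simps)
qed simp

section \<open>The coefficients of \<open>E\<close> in \<open>\<lambda>\<close> and their
  recursion\<close>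

lemma of_nat_mult_nth: "(of_nat n * (\<alpha> :: rat fps fps)) $ i = of_nat n * \<alpha> $ i"
  by (simp flip: fps_of_nat)

text \<open>The coefficient of \<open>\<lambda>^i\<close> in \<open>E\<close>, where the cut at
  \<open>s \<le> i\<close> is exact if \<open>\<lambda>\<close> divides
  \<open>\<alpha>\<close>.\<close>

definition normal_sum_nth :: "rat fps fps \<Rightarrow> nat \<Rightarrow> 'a::rat_algebra_1 weyl" where
  "normal_sum_nth \<alpha> i
     = (\<Sum>s\<le>i. of_Q (1 / fact s) * (weyl_x ^ s * weyl_of_rat_fps (\<alpha> ^ s $ i)))"

lemma mult_of_nat_left_commute: "a * (of_nat n * b) = of_nat n * (a * b :: 'a::semiring_1)"
  by (metis mult.assoc mult_of_nat_commute)

lemma weyl_of_rat_fps_scale: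
  "weyl_of_rat_fps (of_nat n * f) = of_nat n * weyl_of_rat_fps f"
  by (simp add: weyl_of_rat_fps_mult weyl_of_rat_fps_const of_Q_of_nat flip: fps_of_nat)

text \<open>The index shift in differentiating an exponential series: the factor from the derivative
  of a power cancels against the factorial.\<close>

lemma of_Q_fact_Suc:
  "of_Q (1 / fact (Suc t)) * (a * (of_nat (Suc t) * b)) = of_Q (1 / fact t) * (a * b)"
proof -
  have "of_Q (1 / fact (Suc t)) * (a * (of_nat (Suc t) * b))
      = of_Q (1 / fact (Suc t)) * of_nat (Suc t) * (a * b)"
    by (metis mult.assoc mult_of_nat_commute)
  also have "of_Q (1 / fact (Suc t)) * of_nat (Suc t) = (of_Q (1 / fact t) :: 'a)"
    by (simp del: of_nat_Suc flip: of_Q_mult of_Q_of_nat[where 'a = 'a])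
  finally show ?thesis .
qed

text \<open>The equation \<open>\<partial>E/\<partial>\<lambda> = E x F\<close>, read off at
  \<open>\<lambda>^i\<close>.\<close>

lemma normal_sum_nth_Suc:
  fixes F :: "rat fps"
  defines "\<alpha> \<equiv> normal_exponent F"
  shows "of_nat (Suc i) * normal_sum_nth \<alpha> (Suc i)
     = normal_sum_nth \<alpha> i * (weyl_x * weyl_of_rat_fps F :: 'a::rat_algebra_1 weyl)"
proof -
  let ?w = "weyl_of_rat_fps :: rat fps \<Rightarrow> 'a weyl" and ?x = "weyl_x :: 'a weyl"
  let ?q = "\<lambda>s. of_Q (1 / fact s) :: 'a weyl"
  have \<alpha>0: "\<alpha> $ 0 = 0" by (simp add: \<alpha>_def)
  have z: "\<alpha> ^ Suc i $ i = 0" using startsby_zero_power_prefix[OF \<alpha>0] by blast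
  have id0: "inner_deriv 1 = 0" by (rule fps_ext) (simp add: inner_deriv_def)
  \<comment> \<open>Restoring normal order moves the new \<open>x\<close> to the left of
    \<open>\<alpha> ^ s\<close>, at the cost of a \<open>D\<close>-derivative.\<close>
  have R: "?q s * (?x ^ s * ?w (\<alpha> ^ s $ i)) * (?x * ?w F)
      = ?q s * (?x ^ Suc s * ?w (\<alpha> ^ s $ i * F))
        + ?q s * (?x ^ s * ?w (inner_deriv (\<alpha> ^ s) $ i * F))" for s
  proof -
    have "?q s * (?x ^ s * ?w (\<alpha> ^ s $ i)) * (?x * ?w F)
        = ?q s * (?x ^ s * ((?w (\<alpha> ^ s $ i) * ?x) * ?w F))"
      by (simp only: mult.assoc)
    then show ?thesis
      by (simp add: weyl_of_rat_fps_mult_x inner_deriv_def weyl_of_rat_fps_mult power_Suc2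
          distrib_left distrib_right mult.assoc del: power_Suc)
  qed
  have "normal_sum_nth \<alpha> i * (?x * ?w F)
      = (\<Sum>s\<le>i. ?q s * (?x ^ Suc s * ?w (\<alpha> ^ s $ i * F)))
        + (\<Sum>s\<le>i. ?q s * (?x ^ s * ?w (inner_deriv (\<alpha> ^ s) $ i * F)))"
    unfolding normal_sum_nth_def sum_distrib_right R sum.distrib ..
  \<comment> \<open>The added term is zero because \<open>\<alpha> ^ Suc i\<close> has no
    coefficient at \<open>\<lambda>^i\<close>. The term \<open>s = 0\<close> then drops out, as the
    derivative of \<open>1\<close> is zero, and the shifted sum has the same range and power of
    \<open>x\<close> as the first one.\<close>
  also have "(\<Sum>s\<le>i. ?q s * (?x ^ s * ?w (inner_deriv (\<alpha> ^ s) $ i * F)))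
      = (\<Sum>s\<le>Suc i. ?q s * (?x ^ s * ?w (inner_deriv (\<alpha> ^ s) $ i * F)))"
    using z by (simp add: inner_deriv_def del: power_Suc)
  also have "\<dots> = (\<Sum>t\<le>i. ?q (Suc t) * (?x ^ Suc t * ?w (inner_deriv (\<alpha> ^ Suc t) $ i * F)))"
    by (subst sum.atMost_Suc_shift) (simp add: id0 del: power_Suc fact_Suc)
  also have "\<dots> = (\<Sum>t\<le>i. ?q t * (?x ^ Suc t * ?w ((\<alpha> ^ t * inner_deriv \<alpha>) $ i * F)))"
    by (simp only: inner_deriv_power of_nat_mult_nth mult.assoc weyl_of_rat_fps_scale of_Q_fact_Suc)
  \<comment> \<open>Here the differential equation for \<open>\<alpha>\<close> enters and merges the
    two sums.\<close>
  also have "(\<Sum>s\<le>i. ?q s * (?x ^ Suc s * ?w (\<alpha> ^ s $ i * F))) + \<dots>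
      = (\<Sum>s\<le>i. ?q s * (?x ^ Suc s * ?w ((\<alpha> ^ s * fps_deriv \<alpha>) $ i)))"
  proof -
    have "\<alpha> ^ s * fps_deriv \<alpha> = (\<alpha> ^ s + \<alpha> ^ s * inner_deriv \<alpha>) * fps_const F" for s
      unfolding \<alpha>_def normal_exponent_ode by (simp add: algebra_simps)
    then show ?thesis
      by (simp add: weyl_of_rat_fps_add distrib_left distrib_right sum.distrib del: power_Suc)
  qed
  also have "\<dots> = (\<Sum>s\<le>i. ?q (Suc s) * (?x ^ Suc s * ?w (fps_deriv (\<alpha> ^ Suc s) $ i)))"
    by (simp only: fps_deriv_power_Suc of_nat_mult_nth weyl_of_rat_fps_scale of_Q_fact_Suc)
  also have "\<dots> = (\<Sum>s\<le>i. of_nat (Suc i) * (?q (Suc s) * (?x ^ Suc s * ?w (\<alpha> ^ Suc s $ Suc i))))"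
    by (intro sum.cong refl)
      (simp only: fps_deriv_nth Suc_eq_plus1[symmetric] weyl_of_rat_fps_scale
        mult_of_nat_left_commute)
  \<comment> \<open>The missing term \<open>s = 0\<close> is zero, since \<open>1\<close> has no
    coefficient at \<open>\<lambda>^(i+1)\<close>.\<close>
  also have "\<dots> = of_nat (Suc i) * normal_sum_nth \<alpha> (Suc i)"
    unfolding normal_sum_nth_def
    by (subst sum.atMost_Suc_shift) (simp add: sum_distrib_left del: power_Suc of_nat_Suc fact_Suc)
  finally show ?thesis ..
qed

text \<open>Both sides start at \<open>1\<close> and obey the same recursion, in which the factor
  \<open>i + 1\<close> can be cancelled.\<close>

lemma normal_sum_nth_eq:
  "normal_sum_nth (normal_exponent F) i
     = of_Q (1 / fact i) * (weyl_x * weyl_of_rat_fps F :: 'a::rat_algebra_1 weyl) ^ i"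
proof (induction i)
  case 0
  show ?case by (simp add: normal_sum_nth_def weyl_of_rat_fps_1)
next
  case (Suc i)
  let ?y = "weyl_x * weyl_of_rat_fps F :: 'a weyl"
  have "of_nat (Suc i) * normal_sum_nth (normal_exponent F) (Suc i) = of_Q (1 / fact i) * ?y ^ Suc i"
    unfolding normal_sum_nth_Suc Suc power_Suc2 by (rule mult.assoc)
  also have "\<dots> = of_nat (Suc i) * (of_Q (1 / fact (Suc i)) * ?y ^ Suc i)"
  proof -
    have "of_Q (1 / fact i) * ?y ^ Suc i = of_Q (1 / fact (Suc i)) * (of_nat (Suc i) * ?y ^ Suc i)"
      using of_Q_fact_Suc[of i 1 "?y ^ Suc i"] by (simp only: mult_1)
    also have "\<dots> = of_nat (Suc i) * (of_Q (1 / fact (Suc i)) * ?y ^ Suc i)"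
      by (rule mult_of_nat_left_commute)
    finally show ?thesis .
  qed
  finally have "of_nat (Suc i) * (normal_sum_nth (normal_exponent F) (Suc i)
      - of_Q (1 / fact (Suc i)) * ?y ^ Suc i) = 0"
    by (simp only: right_diff_distrib diff_self)
  from of_nat_mult_eq_0_imp[OF this zero_less_Suc] show ?case by simp
qed

lemma formal_exp_lambda_x_F:
  "formal_exp weyl_coeff (lambda_x_F F)
     = Abs_fps (\<lambda>i. fps_const (normal_sum_nth (normal_exponent F) i :: 'a::rat_algebra_1 weyl))"
  unfolding formal_exp_def normal_sum_nth_eq
  by (rule formal_suminf_weyl_coeff[OF formal_sums_exp_lambda_x_F])

lemma normal_exp_eq_normal_exponent:
  "normal_exp_eq TYPE('a::rat_algebra_1) F (normal_exponent F)"
proof -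
  have "formal_sums weyl_coeff (normal_exp_term (normal_exponent F))
      (formal_exp weyl_coeff (lambda_x_F F) :: 'a weyl fps fps)"
    using formal_sums_normal_exp[of "normal_exponent F"]
    by (simp add: formal_exp_lambda_x_F normal_sum_nth_def)
  then show ?thesis
    unfolding normal_exp_eq_def formal_summable_def
    using formal_suminf_weyl_coeff by metis
qed


section \<open>The action on \<open>exp(kx)\<close>\<close>

lemma subst_k_add: "subst_k (\<alpha> + \<beta>) = subst_k \<alpha> + subst_k \<beta>"
  by (intro fps_ext) (simp add: subst_k_def of_Q_add)

text \<open>Thus \<open>k x\<close> and \<open>(\<alpha> + k) x\<close> are both of the form
  \<open>\<beta>(\<lambda>, k) x\<close>, and one computation serves both exponentials.\<close>

lemma subst_k_ser_k: "subst_k ser_k = ser_k"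
  by (intro fps_ext) (simp add: subst_k_def ser_k_def of_Q_0 of_Q_1)

lemma subst_k_x_power_nth:
  "(subst_k \<beta> * ser_const poly_x) ^ s $ i $ j
     = Poly_Mapping.single s (of_Q (\<beta> ^ s $ i $ j) :: 'a::rat_algebra_1)"
proof (induction s arbitrary: i j)
  case 0
  show ?case by (simp add: of_Q_0 of_Q_1 fps_one_nth)
next
  case (Suc s)
  have "(subst_k \<beta> * ser_const poly_x) $ a $ b
      = Poly_Mapping.single 1 (of_Q (\<beta> $ a $ b) :: 'a)" for a b
    by (simp add: subst_k_def ser_const_def of_Q_pm poly_x_def mult_single)
  then show ?case
    by (simp add: fps_mult_nth Suc fps_sum_nth mult_single single_of_Q_sum of_Q_mult)
qed

text \<open>Without a constant term, \<open>\<beta>\<close> has order at least one in total degree,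
  so \<open>\<beta> ^ s\<close> has order at least \<open>s\<close>.\<close>

lemma power_nth_nth_eq_0:
  assumes "\<beta> $ 0 $ 0 = (0 :: rat)" "i + j < s"
  shows "\<beta> ^ s $ i $ j = 0"
  using assms(2)
proof (induction s arbitrary: i j)
  case (Suc s)
  \<comment> \<open>Either the first factor is the constant term, or the total degree left for
    \<open>\<beta> ^ s\<close> has dropped by at least one.\<close>
  have "\<beta> $ a $ b * \<beta> ^ s $ (i - a) $ (j - b) = 0" if "a \<le> i" "b \<le> j" for a b
    using that Suc.prems assms(1) by (cases "a = 0 \<and> b = 0") (auto intro!: Suc.IH)
  then show ?case
    unfolding power_Suc fps_mult_nth fps_sum_nth by (intro sum.neutral ballI) auto
qed simp

text \<open>The bound is by total degree \<open>i + j\<close>, because \<open>k\<close> itself has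
  degree zero in \<open>\<lambda>\<close>.\<close>

lemma formal_sums_exp_subst_k_x:
  assumes "\<beta> $ 0 $ 0 = 0"
  shows "formal_sums poly_coeff (exp_term (subst_k \<beta> * ser_const poly_x))
    (Abs_fps (\<lambda>i. Abs_fps (\<lambda>j. \<Sum>s\<le>i + j.
       Poly_Mapping.single s (of_Q (1 / fact s * \<beta> ^ s $ i $ j) :: 'a::rat_algebra_1))))"
proof -
  have nth: "poly_coeff (i, j) (exp_term (subst_k \<beta> * ser_const poly_x) s)
      = Poly_Mapping.single s (of_Q (1 / fact s * \<beta> ^ s $ i $ j) :: 'a)" for i j s
    by (simp add: poly_coeff_def exp_term_def of_Q_fps_def subst_k_x_power_nth of_Q_pm mult_single
        flip: of_Q_mult)
  show ?thesis
  proof (rule formal_sumsI[where T = "\<lambda>(i, j). {..i + j}"])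
    fix \<iota> :: "nat \<times> nat"
    show "finite (case \<iota> of (i, j) \<Rightarrow> {..i + j})" by (cases \<iota>) simp
  next
    fix \<iota> :: "nat \<times> nat" and s
    assume "s \<notin> (case \<iota> of (i, j) \<Rightarrow> {..i + j})"
    then show "poly_coeff \<iota> (exp_term (subst_k \<beta> * ser_const poly_x) s :: (nat \<Rightarrow>\<^sub>0 'a) fps fps) = 0"
      by (cases \<iota>) (simp add: nth power_nth_nth_eq_0[OF assms] of_Q_0)
  next
    fix \<iota> :: "nat \<times> nat"
    obtain i j where "\<iota> = (i, j)" by (cases \<iota>)
    then show "poly_coeff \<iota> (Abs_fps (\<lambda>i. Abs_fps (\<lambda>j. \<Sum>s\<le>i + j.
        Poly_Mapping.single s (of_Q (1 / fact s * \<beta> ^ s $ i $ j) :: 'a))))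
      = (\<Sum>s\<in>(case \<iota> of (i, j) \<Rightarrow> {..i + j}).
          poly_coeff \<iota> (exp_term (subst_k \<beta> * ser_const poly_x) s))"
      by (simp add: nth) (simp add: poly_coeff_def)
  qed
qed

section \<open>Comparison of coefficients by the binomial theorem\<close>

lemma ser_k_power_nth:
  "(ser_k :: rat fps fps) ^ s $ i $ j = (if i = 0 \<and> j = s then 1 else 0)"
  by (simp add: ser_k_def fps_const_power)

lemma mult_ser_k_power_nth:
  "(\<alpha> * ser_k ^ b) $ i $ j = (if b \<le> j then \<alpha> $ i $ (j - b) else (0 :: rat))"
  by (simp add: ser_k_def fps_const_power fps_X_power_mult_right_nth)

lemma divided_binomial:
  fixes a b :: "rat fps fps"
  shows "1 / fact t * (a + b) ^ t $ i $ j
    = (\<Sum>s\<le>t. 1 / (fact s * fact (t - s)) * (a ^ s * b ^ (t - s)) $ i $ j)"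
proof -
  have nth: "(of_nat n * c) $ i $ j = of_nat n * c $ i $ j" for n and c :: "rat fps fps"
    unfolding of_nat_mult_nth by (simp flip: fps_of_nat)
  have "(a + b) ^ t $ i $ j = (\<Sum>s\<le>t. of_nat (t choose s) * (a ^ s * b ^ (t - s)) $ i $ j)"
    by (simp add: binomial_ring fps_sum_nth mult.assoc nth)
  then show ?thesis
    by (simp add: sum_distrib_left binomial_fact)
qed

text \<open>\<open>D^n\<close> sends \<open>x^j / j!\<close> to \<open>x^(j-n) / (j-n)!\<close>;
  this is the eigenvector property of \<open>exp(kx)\<close> on coefficients of
  \<open>k^j\<close>.\<close>

lemma weyl_act_monomial:
  "weyl_act A (Poly_Mapping.single j (of_Q (1 / fact j)))
     = (\<Sum>n\<le>j. dcoeff A n * Poly_Mapping.single (j - n) (of_Q (1 / fact (j - n)) :: 'a::rat_algebra_1))"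
proof -
  let ?p = "Poly_Mapping.single j (of_Q (1 / fact j)) :: nat \<Rightarrow>\<^sub>0 'a"
  have d: "(pm_deriv ^^ n) ?p
      = (if n \<le> j then Poly_Mapping.single (j - n) (of_Q (1 / fact (j - n))) else 0)" for n
  proof (induction n)
    case (Suc n)
    have "of_nat (j - n) * of_Q (1 / fact (j - n)) = (of_Q (1 / fact (j - Suc n)) :: 'a)"
      if "Suc n \<le> j"
    proof -
      have "j - n = Suc (j - Suc n)" using that by simp
      then show ?thesis by (simp del: of_nat_Suc flip: of_Q_of_nat[where 'a = 'a] of_Q_mult)
    qed
    then show ?case by (simp add: Suc pm_deriv_single)
  qed simp
  have "weyl_act A ?p = (\<Sum>n<Suc j. dcoeff A n * (pm_deriv ^^ n) ?p)"
    by (rule weyl_act_bound) (simp add: d)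
  then show ?thesis by (simp add: d lessThan_Suc_atMost)
qed

lemma ser_act_exp_k_x:
  fixes F :: "rat fps"
  defines "\<alpha> \<equiv> normal_exponent F"
  shows "ser_act (formal_exp weyl_coeff (lambda_x_F F))
      (formal_exp poly_coeff (ser_k * ser_const poly_x))
    = (formal_exp poly_coeff ((subst_k \<alpha> + ser_k) * ser_const poly_x)
         :: (nat \<Rightarrow>\<^sub>0 'a::rat_algebra_1) fps fps)"
proof (intro fps_ext)
  fix i j
  let ?g = "\<lambda>s b. Poly_Mapping.single (s + b)
    (of_Q (1 / (fact s * fact b) * (\<alpha> ^ s * ser_k ^ b) $ i $ j)) :: nat \<Rightarrow>\<^sub>0 'a"
  have k0: "(ser_k :: rat fps fps) $ 0 $ 0 = 0" by (simp add: ser_k_def)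
  have ak0: "(\<alpha> + ser_k) $ 0 $ 0 = 0" by (simp add: \<alpha>_def k0)
  have exp_k: "formal_exp poly_coeff (ser_k * ser_const poly_x) $ r $ s
      = (if r = 0 then Poly_Mapping.single s (of_Q (1 / fact s)) else 0 :: nat \<Rightarrow>\<^sub>0 'a)" for r s
    using formal_suminf_poly_coeff[OF formal_sums_exp_subst_k_x[OF k0, where 'a = 'a]]
    by (auto simp: formal_exp_def subst_k_ser_k ser_k_power_nth of_Q_0 if_distrib sum.delta
        intro!: sum.neutral cong: if_cong)
  \<comment> \<open>The operator is free of \<open>k\<close> and \<open>exp(kx)\<close> is free of
    \<open>\<lambda>\<close>, so the convolution reduces to a single term.\<close>
  have "ser_act (formal_exp weyl_coeff (lambda_x_F F))
        (formal_exp poly_coeff (ser_k * ser_const poly_x)) $ i $ j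
      = weyl_act (normal_sum_nth \<alpha> i) (Poly_Mapping.single j (of_Q (1 / fact j) :: 'a))"
  proof -
    have "(\<Sum>r\<le>i. \<Sum>s\<le>j. weyl_act (fps_const (normal_sum_nth \<alpha> r :: 'a weyl) $ s)
          (if i - r = 0 then Poly_Mapping.single (j - s) (of_Q (1 / fact (j - s))) else 0))
        = (\<Sum>r\<in>{i}. \<Sum>s\<in>{0}. weyl_act (fps_const (normal_sum_nth \<alpha> r :: 'a weyl) $ s)
          (if i - r = 0 then Poly_Mapping.single (j - s) (of_Q (1 / fact (j - s))) else 0))"
      by (intro sum.mono_neutral_cong_right)
        (auto simp: weyl_act_def intro!: sum.neutral sum.mono_neutral_right)
    then show ?thesis
      by (simp add: ser_act_def formal_exp_lambda_x_F exp_k \<alpha>_def)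
  qed
  also have "\<dots> = (\<Sum>n\<le>j. \<Sum>s\<le>i. Poly_Mapping.single (s + (j - n))
      (of_Q (1 / (fact s * fact (j - n)) * \<alpha> ^ s $ i $ n)))"
    by (simp add: weyl_act_monomial normal_sum_nth_def dcoeff_sum dcoeff_normal_term
        sum_distrib_right mult_single mult.commute flip: of_Q_mult)
  \<comment> \<open>With \<open>b = j - n\<close>, the \<open>D^n\<close>-coefficient of
    \<open>\<alpha> ^ s\<close> becomes the \<open>k^j\<close>-coefficient of
    \<open>\<alpha> ^ s * k^b\<close>: this is the substitution of \<open>k\<close> for
    \<open>D\<close>.\<close>
  also have "\<dots> = (\<Sum>b\<le>j. \<Sum>s\<le>i. ?g s b)"
    by (rule sum.reindex_bij_witness[where i = "\<lambda>b. j - b" and j = "\<lambda>n. j - n"])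
      (auto simp: mult_ser_k_power_nth)
  also have "\<dots> = (\<Sum>(s, b)\<in>{..i} \<times> {..j}. ?g s b)"
    by (subst sum.swap) (simp add: sum.cartesian_product)
  \<comment> \<open>The rectangle is enlarged to a triangle, which can be summed along
    \<open>t = s + b\<close>; the new terms vanish since \<open>\<lambda>^s\<close> divides
    \<open>\<alpha> ^ s\<close> and \<open>k^b\<close> is a factor.\<close>
  also have "\<dots> = (\<Sum>(s, b)\<in>{(s, b). s + b \<le> i + j}. ?g s b)"
  proof (rule sum.mono_neutral_left)
    have "{(s, b). s + b \<le> i + j} \<subseteq> {..i + j} \<times> {..i + j}" by auto
    then show "finite {(s, b). s + b \<le> i + j}" by (rule finite_subset) simp
    have "(\<alpha> ^ s * ser_k ^ b) $ i $ j = 0" if "s > i \<or> b > j" for s b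
      using startsby_zero_power_prefix[of \<alpha> s] that by (auto simp: mult_ser_k_power_nth \<alpha>_def)
    then have g0: "?g s b = 0" if "(s, b) \<notin> {..i} \<times> {..j}" for s b
      using that by (simp add: of_Q_0 not_le)
    show "\<forall>p\<in>{(s, b). s + b \<le> i + j} - {..i} \<times> {..j}. (case p of (s, b) \<Rightarrow> ?g s b) = 0"
    proof
      fix p assume "p \<in> {(s, b). s + b \<le> i + j} - {..i} \<times> {..j}"
      then have "(fst p, snd p) \<notin> {..i} \<times> {..j}" by simp
      from g0[OF this] show "(case p of (s, b) \<Rightarrow> ?g s b) = 0"
        by (simp only: case_prod_beta)
    qed
  qed auto
  also have "\<dots> = (\<Sum>t\<le>i + j. \<Sum>s\<le>t. ?g s (t - s))"
    by (rule sum.triangle_reindex_eq)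
  also have "\<dots> = (\<Sum>t\<le>i + j. Poly_Mapping.single t (of_Q (1 / fact t * (\<alpha> + ser_k) ^ t $ i $ j)))"
    unfolding divided_binomial single_of_Q_sum by (intro sum.cong refl) simp
  also have "\<dots> = formal_exp poly_coeff ((subst_k \<alpha> + ser_k) * ser_const poly_x) $ i $ j"
    using formal_suminf_poly_coeff[OF formal_sums_exp_subst_k_x[OF ak0, where 'a = 'a]]
    by (simp add: formal_exp_def subst_k_add subst_k_ser_k)
  finally show "ser_act (formal_exp weyl_coeff (lambda_x_F F))
        (formal_exp poly_coeff (ser_k * ser_const poly_x)) $ i $ j
      = formal_exp poly_coeff ((subst_k \<alpha> + ser_k) * ser_const (poly_x :: nat \<Rightarrow>\<^sub>0 'a)) $ i $ j" .
qed

theorem mainTheorem4: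
  fixes F :: "rat fps"
  shows "formal_summable weyl_coeff (exp_term (lambda_x_F F :: 'a::rat_algebra_1 weyl fps fps))
    \<and> (\<exists>!\<alpha>. normal_exp_eq TYPE('a) F \<alpha>)
    \<and> (\<forall>\<alpha>. normal_exp_eq TYPE('a) F \<alpha> \<longrightarrow>
         formal_summable poly_coeff
           (exp_term (ser_k * ser_const poly_x :: (nat \<Rightarrow>\<^sub>0 'a) fps fps))
         \<and> formal_summable poly_coeff
           (exp_term ((subst_k \<alpha> + ser_k) * ser_const poly_x :: (nat \<Rightarrow>\<^sub>0 'a) fps fps))
         \<and> ser_act (formal_exp weyl_coeff (lambda_x_F F))
             (formal_exp poly_coeff (ser_k * ser_const poly_x))
           = (formal_exp poly_coeff ((subst_k \<alpha> + ser_k) * ser_const poly_x)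
                :: (nat \<Rightarrow>\<^sub>0 'a) fps fps))"
proof (intro conjI allI impI)
  show "formal_summable weyl_coeff (exp_term (lambda_x_F F :: 'a weyl fps fps))"
    using formal_sums_exp_lambda_x_F formal_summable_def by blast
  show "\<exists>!\<alpha>. normal_exp_eq TYPE('a) F \<alpha>"
    using normal_exp_eq_normal_exponent normal_exp_eq_unique by blast
next
  fix \<alpha> assume "normal_exp_eq TYPE('a) F \<alpha>"
  \<comment> \<open>Uniqueness reduces the second identity to the constructed exponent, whose
    constant term is zero.\<close>
  then have \<alpha>: "\<alpha> = normal_exponent F"
    by (rule normal_exp_eq_unique[OF _ normal_exp_eq_normal_exponent])
  have summable: "formal_summable poly_coeff
      (exp_term (subst_k \<beta> * ser_const poly_x :: (nat \<Rightarrow>\<^sub>0 'a) fps fps))"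
    if "\<beta> $ 0 $ 0 = 0" for \<beta>
    using formal_sums_exp_subst_k_x[OF that] formal_summable_def by blast
  show "formal_summable poly_coeff (exp_term (ser_k * ser_const poly_x :: (nat \<Rightarrow>\<^sub>0 'a) fps fps))"
    using summable[of ser_k] by (simp add: subst_k_ser_k) (simp add: ser_k_def)
  show "formal_summable poly_coeff
      (exp_term ((subst_k \<alpha> + ser_k) * ser_const poly_x :: (nat \<Rightarrow>\<^sub>0 'a) fps fps))"
    using summable[of "\<alpha> + ser_k"]
    by (simp add: subst_k_add subst_k_ser_k \<alpha>) (simp add: ser_k_def)
  show "ser_act (formal_exp weyl_coeff (lambda_x_F F))
        (formal_exp poly_coeff (ser_k * ser_const poly_x))
      = (formal_exp poly_coeff ((subst_k \<alpha> + ser_k) * ser_const poly_x)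
           :: (nat \<Rightarrow>\<^sub>0 'a) fps fps)"
    unfolding \<alpha> by (rule ser_act_exp_k_x)
qed

end
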